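(* (Small strike asymptotics.) Let $\beta\in(\frac12,1)$, $\sigma>0$, $S_0>0$, and for $0<K<S_0$ let $$\mathcal{I}(K,S_0)=\inf_{\substack{\int_0^1g(t)\,dt\le K,\ g(0)=S_0,\\ g(t)\ge0,\ 0\le t\le1}}\ \frac12\int_0^1\frac{(g'(t))^2}{\sigma^2g(t)^{2\beta}}\,dt$$ be the rate function of out-of-the-money Asian put options in the CEV model. Then $$\lim_{K\to0}\frac{K}{S_0}\,\mathcal{I}(K,S_0)=\frac{2S_0^{2(1-\beta)}}{\sigma^2(3-2\beta)^2}.$$ Moreover, the right-hand side tends to $\frac{S_0}{2\sigma^2}$ as $\beta\to\frac12$.
   Context: The infimum runs over differentiable functions $g:[0,1]\to[0,\infty)$ satisfying the stated constraints, and the integrand is taken to be $0$ at points where $g(t)=g'(t)=0$. (This $\mathcal{I}(K,S_0)$ governs $\lim_{T\to0}T\log P(T)=-\mathcal{I}(K,S_0)$ for the Asian put price under $dS_t=(r-q)S_t\,dt+\sigma S_t^\beta\,dW_t$.) *)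

theory Defs
  imports "HOL-Analysis.Analysis"
begin

definition put_paths :: "real \<Rightarrow> real \<Rightarrow> (real \<Rightarrow> real) set" where
  "put_paths K S0 =
    {g. g differentiable_on {0..1} \<and> (\<forall>t\<in>{0..1}. 0 \<le> g t) \<and> g 0 = S0 \<and>
        integral {0..1} g \<le> K}"

(* The division is the one of ennreal: a / 0 is infinite for a > 0, and 0 / 0 = 0, so the
   integrand vanishes where g and its derivative both vanish. The derivative is one-sided at
   0 and 1, and values of g outside {0..1} are irrelevant. *)
definition cev_action :: "real \<Rightarrow> real \<Rightarrow> (real \<Rightarrow> real) \<Rightarrow> ennreal" where
  "cev_action \<beta> \<sigma> g =
    ennreal (1 / 2) *
      (\<integral>\<^sup>+ t\<in>{0..1}. (ennreal ((vector_derivative g (at t within {0..1}))\<^sup>2)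
                    / ennreal (\<sigma>\<^sup>2 * g t powr (2 * \<beta>))) \<partial>lborel)"

(* Valued in ennreal, since the action of an individual path may be infinite. *)
definition cev_put_rate :: "real \<Rightarrow> real \<Rightarrow> real \<Rightarrow> real \<Rightarrow> ennreal" where
  "cev_put_rate \<beta> \<sigma> K S0 = (INF g\<in>put_paths K S0. cev_action \<beta> \<sigma> g)"

end

theory Submission
  imports Defs
begin

text \<open>Put \<open>p = 3/2 - \<beta>\<close>. A path with mean at most \<open>K < S0\<close> comes down to the level \<open>K\<close> at some
first time \<open>\<tau>\<close>. By Cauchy--Schwarz on \<open>[0, \<tau>]\<close>, the integral of
\<open>-g' g powr (1/2 - \<beta>)\<close>, which is \<open>(S0 powr p - K powr p) / p\<close>, is at most the square root of
\<open>K\<close> times the integral of \<open>g'\<^sup>2 / g powr (2 * \<beta>)\<close>. Equality would force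
\<open>g' = - c * g powr (\<beta> + 1/2)\<close>; the solution of this equation whose integral over
\<open>[0, \<infinity>)\<close> equals \<open>K\<close> has action at most \<open>S0 powr (2 * p) / (2 * K * \<sigma>\<^sup>2 * p\<^sup>2)\<close>.
The two bounds agree to leading order as \<open>K\<close> tends to \<open>0\<close>.\<close>

text \<open>If the right-hand side is infinite there is nothing to prove. Otherwise \<open>f\<close>
  is Lebesgue integrable, hence gauge integrable with the same value, and monotonicity of the gauge
  integral applies. So \<open>h\<close> need not be absolutely integrable.\<close>

lemma has_integral_le_set_nn_integral:
  fixes f h :: "'a::euclidean_space \<Rightarrow> real"
  assumes h: "(h has_integral I) S" and S: "S \<in> sets lebesgue"
    and f: "f \<in> borel_measurable (lebesgue_on S)"
    and nonneg: "\<And>x. x \<in> S \<Longrightarrow> 0 \<le> f x" and le: "\<And>x. x \<in> S \<Longrightarrow> h x \<le> f x"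
  shows "ennreal I \<le> (\<integral>\<^sup>+x\<in>S. ennreal (f x) \<partial>lborel)"
proof -
  have eq: "(\<integral>\<^sup>+x\<in>S. ennreal (f x) \<partial>lborel) = (\<integral>\<^sup>+x. ennreal (f x) \<partial>lebesgue_on S)"
    using S by (simp add: nn_integral_restrict_space nn_integral_completion)
  show ?thesis
  proof (cases "(\<integral>\<^sup>+x. ennreal (f x) \<partial>lebesgue_on S)" rule: ennreal_cases)
    case (real r)
    have AE: "AE x in lebesgue_on S. 0 \<le> f x"
      using nonneg by (intro AE_I2) simp
    have "has_bochner_integral (lebesgue_on S) f r"
      by (rule has_bochner_integral_nn_integral[OF f AE real])
    then have "(f has_integral r) S"
      using has_integral_integral_lebesgue_on[OF _ S, of f]
      by (simp add: has_bochner_integral_iff)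
    then have "I \<le> r"
      using has_integral_le[OF h] le by blast
    then show ?thesis
      by (simp add: eq real ennreal_leI)
  qed (simp add: eq)
qed

text \<open>The infimum of the closed set of times with \<open>g t \<le> K\<close> serves as
  \<open>\<tau>\<close>. A value strictly below \<open>K\<close> there is impossible, since the
  intermediate value theorem would then give an earlier time with value \<open>K\<close>.\<close>

lemma first_hitting_time:
  fixes g :: "real \<Rightarrow> real"
  assumes cont: "continuous_on {a..b} g"
    and start: "K \<le> g a" and s: "s \<in> {a..b}" "g s \<le> K"
  obtains \<tau> where "\<tau> \<in> {a..b}" "g \<tau> = K" "\<And>t. t \<in> {a..\<tau>} \<Longrightarrow> K \<le> g t"
proof -
  define A where "A = {t \<in> {a..b}. g t \<le> K}"
  have "closed A"
    unfolding A_def by (intro continuous_on_closed_Collect_le cont) auto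
  have "A \<noteq> {}" "bdd_below A"
    using s by (auto simp: A_def intro!: bdd_belowI[of _ a])
  have \<tau>: "Inf A \<in> A"
    by (rule closed_contains_Inf) fact+
  have before: "K < g t" if "t \<in> {a..<Inf A}" for t
  proof (rule ccontr)
    assume "\<not> K < g t"
    then have "t \<in> A"
      using that \<tau> by (auto simp: A_def)
    then show False
      using cInf_lower[OF _ \<open>bdd_below A\<close>] that by fastforce
  qed
  have "g (Inf A) = K"
  proof (rule ccontr)
    assume "g (Inf A) \<noteq> K"
    then have less: "g (Inf A) < K"
      using \<tau> by (auto simp: A_def)
    have "continuous_on {a..Inf A} g"
      using cont \<tau> by (auto simp: A_def intro: continuous_on_subset)
    then obtain x where "a \<le> x" "x \<le> Inf A" "g x = K"
      using IVT2'[of g "Inf A" K a] start less \<tau> by (auto simp: A_def)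
    then show False
      using before[of x] less by (cases "x = Inf A") auto
  qed
  moreover from this have "K \<le> g t" if "t \<in> {a..Inf A}" for t
    using before[of t] that by (cases "t = Inf A") auto
  ultimately show ?thesis
    using that[of "Inf A"] \<tau> by (simp add: A_def)
qed

lemma exists_le_of_integral_le:
  fixes g :: "real \<Rightarrow> real"
  assumes cont: "continuous_on {0..1} g" and "integral {0..1} g \<le> K"
  shows "\<exists>s\<in>{0..1}. g s \<le> K"
proof -
  obtain s where s: "s \<in> {0..1}" "\<And>t. t \<in> {0..1} \<Longrightarrow> g s \<le> g t"
    using continuous_attains_inf[OF _ _ cont] by auto
  have "integral {0..1::real} (\<lambda>_. g s) \<le> integral {0..1} g"
    using s cont by (intro integral_le integrable_continuous_real) auto
  then show ?thesis
    using s(1) assms(2) by (intro bexI[of _ s]) simp_all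
qed

lemma cev_action_lower_bound:
  fixes \<beta> \<sigma> K S0 :: real
  assumes "0 < \<sigma>" "0 < K" "K < S0" and g: "g \<in> put_paths K S0"
  defines "p \<equiv> 3 / 2 - \<beta>"
  assumes p: "0 < p"
  shows "ennreal (((S0 powr p - K powr p) / p)\<^sup>2 / (2 * K * \<sigma>\<^sup>2)) \<le> cev_action \<beta> \<sigma> g"
proof -
  define D where "D = (\<lambda>t. vector_derivative g (at t within {0..1}))"
  have diff: "g differentiable_on {0..1}" and g0: "g 0 = S0" and gint: "integral {0..1} g \<le> K"
    and gnn: "\<And>t. t \<in> {0..1} \<Longrightarrow> 0 \<le> g t"
    using g by (auto simp: put_paths_def)
  have cont: "continuous_on {0..1} g"
    by (rule differentiable_imp_continuous_on[OF diff])
  obtain s where "s \<in> {0..1}" "g s \<le> K"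
    using exists_le_of_integral_le[OF cont gint] by blast
  \<comment> \<open>Up to \<open>\<tau>\<close> the path stays at or above \<open>K > 0\<close>, so
    its powers are differentiable and the denominator in the action is positive; later the path may
    vanish.\<close>
  then obtain \<tau> where \<tau>: "\<tau> \<in> {0..1}" "g \<tau> = K" and gK: "\<And>t. t \<in> {0..\<tau>} \<Longrightarrow> K \<le> g t"
    using first_hitting_time[OF cont, of K s] g0 \<open>K < S0\<close> by auto
  have sub: "{0..\<tau>} \<subseteq> {0..1}"
    using \<tau> by auto
  have cont\<tau>: "continuous_on {0..\<tau>} g"
    using cont sub by (rule continuous_on_subset)
  have gpos: "0 < g t" if "t \<in> {0..\<tau>}" for t
    using gK[OF that] \<open>0 < K\<close> by simp
  have D: "(g has_real_derivative D t) (at t within {0..\<tau>})" if "t \<in> {0..\<tau>}" for t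
  proof -
    have "(g has_vector_derivative D t) (at t within {0..1})"
      using diff that sub unfolding D_def differentiable_on_def
      by (auto simp flip: vector_derivative_works)
    then show ?thesis
      using has_vector_derivative_within_subset[OF _ sub]
      by (simp add: has_real_derivative_iff_has_vector_derivative)
  qed
  \<comment> \<open>The fundamental theorem makes \<open>D\<close> gauge integrable, and
    measurability follows from that.\<close>
  have "(D has_integral (g \<tau> - g 0)) {0..\<tau>}"
    using \<tau> D by (intro fundamental_theorem_of_calculus)
      (auto simp: has_real_derivative_iff_has_vector_derivative)
  then have D_meas: "D \<in> borel_measurable (lebesgue_on {0..\<tau>})"
    by (intro integrable_imp_measurable) blast
  have g_meas: "g \<in> borel_measurable (lebesgue_on {0..\<tau>})"
    by (intro continuous_imp_measurable_on_sets_lebesgue cont\<tau>) simp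
  define A where "A = (S0 powr p - K powr p) / p"
  \<comment> \<open>This value maximizes \<open>2 * c * A - c\<^sup>2 * K\<close>, and the maximum
    is \<open>A\<^sup>2 / K\<close>, which is the Cauchy--Schwarz bound.\<close>
  define c where "c = A / K"
  \<comment> \<open>Cauchy--Schwarz is replaced by the pointwise inequality \<open>h \<le> f\<close>, whose left-hand side has an
    explicit gauge integral: the derivative of a differentiable path need not be Lebesgue integrable.\<close>
  define h where "h = (\<lambda>t. (2 * c * - (g t powr (p - 1) * D t) - c\<^sup>2 * g t) / \<sigma>\<^sup>2)"
  have "((\<lambda>t. g t powr (p - 1) * D t) has_integral (g \<tau> powr p / p - g 0 powr p / p)) {0..\<tau>}"
  proof (rule fundamental_theorem_of_calculus)
    fix t assume t: "t \<in> {0..\<tau>}"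
    have "((\<lambda>t. g t powr p / p) has_real_derivative g t powr (p - 1) * D t) (at t within {0..\<tau>})"
      using p gpos[OF t] D[OF t] by (auto intro!: derivative_eq_intros)
    then show "((\<lambda>t. g t powr p / p) has_vector_derivative g t powr (p - 1) * D t) (at t within {0..\<tau>})"
      by (simp add: has_real_derivative_iff_has_vector_derivative)
  qed (use \<tau> in simp)
  then have "((\<lambda>t. - (g t powr (p - 1) * D t)) has_integral A) {0..\<tau>}"
    using \<tau>(2) g0 by (auto simp: A_def diff_divide_distrib dest: has_integral_neg)
  moreover have "(g has_integral (integral {0..\<tau>} g)) {0..\<tau>}"
    using cont\<tau> by (simp add: integrable_continuous_real integrable_integral)
  ultimately have h: "(h has_integral (2 * c * A - c\<^sup>2 * integral {0..\<tau>} g) / \<sigma>\<^sup>2) {0..\<tau>}"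
    unfolding h_def by (intro has_integral_divide has_integral_diff has_integral_mult_right)
  \<comment> \<open>Since \<open>g\<close> is nonnegative after \<open>\<tau>\<close>, its mass up
    to \<open>\<tau>\<close> is still at most \<open>K\<close>.\<close>
  have "integral {0..\<tau>} g \<le> integral {0..1} g"
    using sub cont cont\<tau> gnn by (intro integral_subset_le integrable_continuous_real) auto
  then have "c\<^sup>2 * integral {0..\<tau>} g \<le> c\<^sup>2 * K"
    using gint by (intro mult_left_mono) auto
  moreover have "2 * c * A - c\<^sup>2 * K = A\<^sup>2 / K"
    using \<open>0 < K\<close> by (simp add: c_def power2_eq_square)
  ultimately have I: "A\<^sup>2 / K / \<sigma>\<^sup>2 \<le> (2 * c * A - c\<^sup>2 * integral {0..\<tau>} g) / \<sigma>\<^sup>2"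
    by (intro divide_right_mono) auto
  define f where "f = (\<lambda>t. (D t)\<^sup>2 / (\<sigma>\<^sup>2 * g t powr (2 * \<beta>)))"
  have f_meas: "f \<in> borel_measurable (lebesgue_on {0..\<tau>})"
    unfolding f_def using D_meas g_meas by measurable
  have hf: "h t \<le> f t" if "t \<in> {0..\<tau>}" for t
  proof -
    have "g t powr (p - 1) = g t powr (1 / 2) / g t powr \<beta>"
      by (simp add: p_def flip: powr_diff)
    moreover have "g t = (g t powr (1 / 2))\<^sup>2" "g t powr (2 * \<beta>) = (g t powr \<beta>)\<^sup>2"
      using gpos[OF that] by (simp_all add: powr_powr mult.commute flip: powr_numeral)
    \<comment> \<open>Expanded by means of the identities above, this square is exactly
      \<open>f t - h t\<close>.\<close>
    moreover have "0 \<le> (D t / g t powr \<beta> + c * g t powr (1 / 2))\<^sup>2 / \<sigma>\<^sup>2"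
      by simp
    ultimately show ?thesis
      using \<open>0 < \<sigma>\<close> unfolding h_def f_def
      by (simp add: power2_sum power_mult_distrib power_divide add_divide_distrib
          diff_divide_distrib mult_ac)
  qed
  have "ennreal (A\<^sup>2 / K / \<sigma>\<^sup>2) \<le> (\<integral>\<^sup>+t\<in>{0..\<tau>}. ennreal (f t) \<partial>lborel)"
    by (rule order_trans[OF ennreal_leI[OF I] has_integral_le_set_nn_integral[OF h _ f_meas]])
      (auto simp: f_def intro: hf[unfolded f_def])
  \<comment> \<open>On \<open>{0..\<tau>}\<close> the denominator is positive, so the real quotient
    \<open>f\<close> agrees with the quotient in \<open>ennreal\<close>; elsewhere the left-hand
    side is \<open>0\<close>.\<close>
  also have "\<dots> \<le> (\<integral>\<^sup>+t\<in>{0..1}. ennreal ((D t)\<^sup>2) / ennreal (\<sigma>\<^sup>2 * g t powr (2 * \<beta>)) \<partial>lborel)"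
  proof (rule nn_integral_mono)
    fix t :: real
    show "ennreal (f t) * indicator {0..\<tau>} t
        \<le> ennreal ((D t)\<^sup>2) / ennreal (\<sigma>\<^sup>2 * g t powr (2 * \<beta>)) * indicator {0..1} t"
      using gpos[of t] sub \<open>0 < \<sigma>\<close> by (auto simp: f_def divide_ennreal split: split_indicator)
  qed
  finally have "ennreal (1 / 2) * ennreal (A\<^sup>2 / K / \<sigma>\<^sup>2) \<le> cev_action \<beta> \<sigma> g"
    unfolding cev_action_def D_def by (intro mult_left_mono) auto
  moreover have "ennreal (1 / 2) * ennreal (A\<^sup>2 / K / \<sigma>\<^sup>2) = ennreal (A\<^sup>2 / (2 * K * \<sigma>\<^sup>2))"
    using \<open>0 < K\<close> by (subst ennreal_mult[symmetric]) (auto simp: mult_ac)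
  ultimately show ?thesis
    by (simp add: A_def)
qed

lemma cev_put_rate_upper_bound:
  fixes \<beta> \<sigma> K S0 :: real
  assumes \<beta>: "1 / 2 < \<beta>" "\<beta> < 1" and "0 < \<sigma>" "0 < K" "0 < S0"
  defines "p \<equiv> 3 / 2 - \<beta>"
  shows "cev_put_rate \<beta> \<sigma> K S0 \<le> ennreal ((S0 powr p / p)\<^sup>2 / (2 * K * \<sigma>\<^sup>2))"
proof -
  define \<gamma> where "\<gamma> = \<beta> - 1 / 2"
  have \<gamma>: "0 < \<gamma>" "0 < p" "p = 1 - \<gamma>" and \<beta>\<gamma>: "2 * \<beta> = 2 * \<gamma> + 1"
    using \<beta> by (auto simp: \<gamma>_def p_def)
  \<comment> \<open>Chosen so that the path below has total mass
    \<open>S0 powr p / (c * p) = K\<close> over the whole half-line.\<close>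
  define c where "c = S0 powr p / (K * p)"
  have c: "0 < c"
    using \<gamma> assms by (simp add: c_def)
  \<comment> \<open>Since \<open>\<beta> + 1 / 2 = 1 + \<gamma>\<close>, the equation
    \<open>g' = - c * g powr (1 + \<gamma>)\<close> becomes linear for
    \<open>u = g powr - \<gamma>\<close>, namely \<open>u' = c * \<gamma>\<close>. As
    \<open>\<gamma> > 0\<close>, the solution stays positive for all
    \<open>t \<ge> 0\<close>.\<close>
  define u where "u = (\<lambda>t. S0 powr - \<gamma> + c * \<gamma> * t)"
  have u: "0 < u t" if "0 \<le> t" for t
    using that c \<gamma> \<open>0 < S0\<close> by (auto simp: u_def intro!: add_pos_nonneg)
  define g where "g = (\<lambda>t. u t powr (- 1 / \<gamma>))"
  \<comment> \<open>The exponent \<open>1 - 1 / \<gamma>\<close> equals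
    \<open>- p / \<gamma>\<close> and is negative, so this is the antiderivative of \<open>g\<close>
    that vanishes at infinity, and \<open>- G 0\<close> is the total mass.\<close>
  define G where "G = (\<lambda>t. - (u t powr (1 - 1 / \<gamma>)) / (c * p))"
  have du: "(u has_real_derivative c * \<gamma>) (at t within X)" for t X
    unfolding u_def by (auto intro!: derivative_eq_intros)
  have dg: "(g has_real_derivative - c * u t powr (- 1 / \<gamma> - 1)) (at t within X)"
    if "0 \<le> t" for t X
    unfolding g_def using u[OF that] \<gamma>
    by (auto intro!: derivative_eq_intros du)
  have dG: "(G has_real_derivative g t) (at t within X)" if "0 \<le> t" for t X
  proof -
    have "(G has_real_derivative
        - ((1 - 1 / \<gamma>) * u t powr (1 - 1 / \<gamma> - 1) * (c * \<gamma>)) / (c * p)) (at t within X)"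
      unfolding G_def using u[OF that] \<gamma>(2) c
      by (auto intro!: derivative_eq_intros du)
    moreover have "(1 - 1 / \<gamma>) * (c * \<gamma>) = - (c * p)"
      using \<gamma>(1) by (simp add: \<gamma>(3) field_simps)
    then have "(1 - 1 / \<gamma>) * w * (c * \<gamma>) = - (c * p) * w" for w
      by (simp only: mult.commute[of _ w] mult.assoc)
    moreover have "- (- (c * p) * w) / (c * p) = w" for w
      using c \<gamma>(2) by simp
    ultimately show ?thesis
      by (simp only: g_def) simp
  qed
  have g_integral: "(g has_integral (G 1 - G 0)) {0..1}"
    by (intro fundamental_theorem_of_calculus)
      (auto simp flip: has_real_derivative_iff_has_vector_derivative intro: dG)
  have "- \<gamma> * (1 - 1 / \<gamma>) = p"
    using \<gamma>(1) by (simp add: \<gamma>(3) right_diff_distrib)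
  then have "- G 0 = S0 powr p / (c * p)"
    by (simp add: G_def u_def powr_powr)
  also have "\<dots> = K"
    using \<gamma> assms by (simp add: c_def)
  finally have "- G 0 = K" .
  moreover have "G 1 \<le> 0"
    using c \<gamma> by (simp add: G_def)
  ultimately have mass: "G 1 - G 0 \<le> K"
    by simp
  have "- \<gamma> * (- 1 / \<gamma>) = 1"
    using \<gamma> by simp
  then have "g 0 = S0"
    using \<open>0 < S0\<close> by (simp add: g_def u_def powr_powr)
  moreover have "g differentiable_on {0..1}"
    using dg unfolding differentiable_on_def
    by (meson atLeastAtMost_iff field_differentiable_imp_differentiable field_differentiable_def)
  moreover have "0 \<le> g t" for t
    by (simp add: g_def)
  ultimately have path: "g \<in> put_paths K S0"
    using mass g_integral by (simp add: put_paths_def integral_unique)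
  \<comment> \<open>Because \<open>g'\<^sup>2 = c\<^sup>2 * g powr (2 * \<beta> + 1)\<close>, the
    integrand is a constant multiple of \<open>g\<close>, and the mass bound controls the
    action.\<close>
  have action: "ennreal ((vector_derivative g (at t within {0..1}))\<^sup>2)
      / ennreal (\<sigma>\<^sup>2 * g t powr (2 * \<beta>)) = ennreal (c\<^sup>2 / \<sigma>\<^sup>2 * g t)" if t: "t \<in> {0..1}" for t
  proof -
    have vd: "vector_derivative g (at t within {0..1}) = - c * u t powr (- 1 / \<gamma> - 1)"
      using t dg[of t "{0..1}"]
      by (intro vector_derivative_within_closed_interval)
        (auto simp: has_real_derivative_iff_has_vector_derivative)
    have pos: "0 < u t" "0 < g t"
      using u[of t] t by (auto simp: g_def)
    have "(u t powr (- 1 / \<gamma> - 1))\<^sup>2 = u t powr (2 * (- 1 / \<gamma> - 1))"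
      using pos by (simp add: powr_powr mult.commute flip: powr_numeral)
    also have "2 * (- 1 / \<gamma> - 1) = - 1 / \<gamma> + (- 1 / \<gamma>) * (2 * \<beta>)"
      using \<gamma>(1) unfolding \<beta>\<gamma> by (simp add: field_simps)
    also have "u t powr \<dots> = g t * g t powr (2 * \<beta>)"
      by (simp only: g_def powr_add powr_powr)
    finally show ?thesis
      using pos \<open>0 < \<sigma>\<close>
      by (simp add: vd divide_ennreal power_mult_distrib)
  qed
  have "(\<integral>\<^sup>+t\<in>{0..1}. (ennreal ((vector_derivative g (at t within {0..1}))\<^sup>2)
                    / ennreal (\<sigma>\<^sup>2 * g t powr (2 * \<beta>))) \<partial>lborel)
      = (\<integral>\<^sup>+t. ennreal (c\<^sup>2 / \<sigma>\<^sup>2 * g t) * indicator {0..1} t \<partial>lborel)"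
    by (intro nn_integral_cong) (auto simp: action split: split_indicator)
  also have "\<dots> = ennreal (c\<^sup>2 / \<sigma>\<^sup>2 * (G 1 - G 0))"
    by (intro nn_integral_has_integral_lebesgue' has_integral_mult_right g_integral)
      (simp add: g_def)
  also have "\<dots> \<le> ennreal (c\<^sup>2 / \<sigma>\<^sup>2 * K)"
    using mass by (intro ennreal_leI mult_left_mono) auto
  finally have "cev_action \<beta> \<sigma> g \<le> ennreal (1 / 2) * ennreal (c\<^sup>2 / \<sigma>\<^sup>2 * K)"
    unfolding cev_action_def by (intro mult_left_mono) auto
  \<comment> \<open>The choice of \<open>c\<close> gives
    \<open>c * K = S0 powr p / p\<close>.\<close>
  also have "\<dots> = ennreal ((S0 powr p / p)\<^sup>2 / (2 * K * \<sigma>\<^sup>2))"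
    using \<open>0 < K\<close> \<open>0 < \<sigma>\<close> \<gamma>(2) by (subst ennreal_mult[symmetric]) (simp_all add: c_def power2_eq_square mult_ac)
  finally show ?thesis
    unfolding cev_put_rate_def using INF_lower2[OF path] by blast
qed

theorem proposition13:
  fixes \<beta> \<sigma> S0 :: real
  assumes "1 / 2 < \<beta>" and "\<beta> < 1" and "0 < \<sigma>" and "0 < S0"
  shows "((\<lambda>K. ennreal (K / S0) * cev_put_rate \<beta> \<sigma> K S0)
            \<longlongrightarrow> ennreal (2 * S0 powr (2 * (1 - \<beta>)) / (\<sigma>\<^sup>2 * (3 - 2 * \<beta>)\<^sup>2))) (at_right 0)
       \<and> ((\<lambda>b. 2 * S0 powr (2 * (1 - b)) / (\<sigma>\<^sup>2 * (3 - 2 * b)\<^sup>2))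
            \<longlongrightarrow> S0 / (2 * \<sigma>\<^sup>2)) (at_right (1 / 2))"
proof
  define p where "p = 3 / 2 - \<beta>"
  have p: "0 < p"
    using assms by (simp add: p_def)
  \<comment> \<open>This uses \<open>3 - 2 * \<beta> = 2 * p\<close> and
    \<open>2 * (1 - \<beta>) + 1 = 2 * p\<close>.\<close>
  have "2 * S0 powr (2 * (1 - \<beta>)) / (\<sigma>\<^sup>2 * (3 - 2 * \<beta>)\<^sup>2) = (S0 powr p / p)\<^sup>2 / (2 * S0 * \<sigma>\<^sup>2)"
  proof -
    have "(S0 powr p)\<^sup>2 = S0 powr (2 * (1 - \<beta>) + 1)"
      using assms(4) by (simp add: p_def powr_powr left_diff_distrib mult.commute[of \<beta>] flip: powr_numeral)
    also have "\<dots> = S0 powr (2 * (1 - \<beta>)) * S0"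
      using assms(4) by (subst powr_add) simp
    finally have "(S0 powr p)\<^sup>2 = S0 powr (2 * (1 - \<beta>)) * S0" .
    moreover have "3 - 2 * \<beta> = 2 * p"
      by (simp add: p_def)
    ultimately show ?thesis
      using assms p by (simp add: power_divide power_mult_distrib)
  qed
  \<comment> \<open>The factor \<open>K / S0\<close> cancels the \<open>1 / K\<close> in both
    bounds. The upper one becomes constant in \<open>K\<close>, and the lower one differs from it
    only through \<open>K powr p\<close>, which tends to \<open>0\<close>.\<close>
  moreover have "((\<lambda>K. ennreal (K / S0) * cev_put_rate \<beta> \<sigma> K S0)
      \<longlongrightarrow> ennreal ((S0 powr p / p)\<^sup>2 / (2 * S0 * \<sigma>\<^sup>2))) (at_right 0)"
  proof (rule tendsto_sandwich)
    have ev: "eventually (\<lambda>K. 0 < K \<and> K < S0) (at_right 0)"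
      using assms(4) by (auto simp: eventually_at_right_field)
    show "eventually (\<lambda>K. ennreal (((S0 powr p - K powr p) / p)\<^sup>2 / (2 * S0 * \<sigma>\<^sup>2))
        \<le> ennreal (K / S0) * cev_put_rate \<beta> \<sigma> K S0) (at_right 0)"
      using ev
    proof eventually_elim
      case (elim K)
      have "ennreal (((S0 powr p - K powr p) / p)\<^sup>2 / (2 * S0 * \<sigma>\<^sup>2))
          = ennreal (K / S0) * ennreal (((S0 powr p - K powr p) / p)\<^sup>2 / (2 * K * \<sigma>\<^sup>2))"
        using elim by (simp flip: ennreal_mult)
      also have "\<dots> \<le> ennreal (K / S0) * cev_put_rate \<beta> \<sigma> K S0"
        unfolding cev_put_rate_def p_def
        using elim assms p cev_action_lower_bound[of \<sigma> K S0 _ \<beta>]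
        by (intro mult_left_mono INF_greatest) (auto simp: p_def)
      finally show ?case .
    qed
    show "eventually (\<lambda>K. ennreal (K / S0) * cev_put_rate \<beta> \<sigma> K S0
        \<le> ennreal ((S0 powr p / p)\<^sup>2 / (2 * S0 * \<sigma>\<^sup>2))) (at_right 0)"
      using ev
    proof eventually_elim
      case (elim K)
      have "ennreal (K / S0) * cev_put_rate \<beta> \<sigma> K S0
          \<le> ennreal (K / S0) * ennreal ((S0 powr p / p)\<^sup>2 / (2 * K * \<sigma>\<^sup>2))"
        using elim assms cev_put_rate_upper_bound[of \<beta> \<sigma> K S0]
        by (intro mult_left_mono) (auto simp: p_def)
      also have "\<dots> = ennreal ((S0 powr p / p)\<^sup>2 / (2 * S0 * \<sigma>\<^sup>2))"
        using elim by (simp flip: ennreal_mult)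
      finally show ?case .
    qed
    have "((\<lambda>K. K powr p) \<longlongrightarrow> 0) (at_right 0)"
      using p by (intro tendsto_eq_intros refl) (auto simp: eventually_at_filter)
    then have "((\<lambda>K. ((S0 powr p - K powr p) / p)\<^sup>2 / (2 * S0 * \<sigma>\<^sup>2))
        \<longlongrightarrow> ((S0 powr p - 0) / p)\<^sup>2 / (2 * S0 * \<sigma>\<^sup>2)) (at_right 0)"
      using p assms by (intro tendsto_divide tendsto_power tendsto_diff tendsto_const) auto
    then show "((\<lambda>K. ennreal (((S0 powr p - K powr p) / p)\<^sup>2 / (2 * S0 * \<sigma>\<^sup>2)))
        \<longlongrightarrow> ennreal ((S0 powr p / p)\<^sup>2 / (2 * S0 * \<sigma>\<^sup>2))) (at_right 0)"
      by (intro tendsto_ennrealI) simp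
  qed simp
  ultimately show "((\<lambda>K. ennreal (K / S0) * cev_put_rate \<beta> \<sigma> K S0)
      \<longlongrightarrow> ennreal (2 * S0 powr (2 * (1 - \<beta>)) / (\<sigma>\<^sup>2 * (3 - 2 * \<beta>)\<^sup>2))) (at_right 0)"
    by simp
  \<comment> \<open>The expression is continuous at \<open>b = 1 / 2\<close>, where the power of
    \<open>S0\<close> is \<open>S0\<close> itself and
    \<open>(3 - 2 * b)\<^sup>2 = 4\<close>.\<close>
  show "((\<lambda>b. 2 * S0 powr (2 * (1 - b)) / (\<sigma>\<^sup>2 * (3 - 2 * b)\<^sup>2))
      \<longlongrightarrow> S0 / (2 * \<sigma>\<^sup>2)) (at_right (1 / 2))"
    using assms by (auto intro!: tendsto_eq_intros)
qed

end
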